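(* Let $n\ge 2$ and let $\gamma: X \to \mathbb{R}^n$ be a generalized path. Then: (i) $\mathsf{len}(\gamma) = 0$ if and only if $\gamma$ is a constant function. (ii) If $h: Y \to X$ is a homeomorphism, then $\mathsf{len}(\gamma \circ h) = \mathsf{len}(\gamma)$. (iii) If $\Phi: \mathbb{R}^n \to \mathbb{R}^n$ is an isometry, then $\mathsf{len}(\Phi \circ \gamma) = \mathsf{len}(\gamma)$.
   Context: A continuum is a nonempty compact connected metric space. A generalized path is a continuous map $\gamma: X\to\mathbb{R}^n$ where $X$ is a locally connected metric continuum. Definition of $\mathsf{len}=\mathsf{len}_n$. For a unit vector $u\in \mathbb{S}^{n-1}$, $x\in[0,1]$, $\mu\in(0,1]$ and $j\in\mathbb{Z}$ put $S_j^{x,u,\mu}=\{z\in\mathbb{R}^n: \mu(j+x)\le\langle z,u\rangle\le\mu(j+1+x)\}$, and for $A\subset\mathbb{R}^n$ put $\|A\|_u=\mathrm{diam}\{\langle z,u\rangle: z\in A\}$. Given a generalized path $\gamma:X\to\mathbb{R}^n$, let $C_0,C_1,C_2,\ldots$ (a finite or infinite list) enumerate all connected components $C$ of the sets $\gamma^{-1}(S_j^{x,u,\mu})$, $j\in\mathbb{Z}$, for which $\|\gamma(C)\|_u>0$, ordered so that $\|\gamma(C_k)\|_u\ge\|\gamma(C_{k+1})\|_u$ for all $k$ (this is possible, since for each $\varepsilon>0$ only finitely many such components have $\|\gamma(C)\|_u\ge\varepsilon$). Put $L^{x,u,\mu}(\gamma)=\sum_{k\ge0}2^{-k}\|\gamma(C_k)\|_u$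 (missing terms count as $0$), and $$\mathsf{len}(\gamma)=\int_0^1\int_{\mathbb{S}^{n-1}}\int_0^1 L^{x,u,\mu}(\gamma)\,dx\,d\sigma(u)\,d\mu,$$ where $\sigma$ is the rotation-invariant probability measure on $\mathbb{S}^{n-1}$. (Replacing $u$ by $-u$ does not change the integral over $x$, so equivalently one integrates over $(n-1)$-dimensional real projective space; for $n=2$, identifying $\mathbb{R}^2$ with $\mathbb{C}$, one may take $u=ie^{t\pi i}$ and integrate $dt$ over $t\in[0,1]$.) *)

theory Defs
  imports "HOL-Analysis.Analysis" "HOL-Probability.Probability_Measure"
begin

definition continuum :: "'a::metric_space set \<Rightarrow> bool" where
  "continuum X \<longleftrightarrow> X \<noteq> {} \<and> compact X \<and> connected X"

definition generalized_path :: "'a::metric_space set \<Rightarrow> ('a \<Rightarrow> real^'n) \<Rightarrow> bool" where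
  "generalized_path X \<gamma> \<longleftrightarrow> continuum X \<and> locally connected X \<and> continuous_on X \<gamma>"


text \<open>
  The rotation-invariant probability measure on the unit sphere, realised as the image of the
  uniform distribution on the unit ball under radial projection \<open>z \<mapsto> z / norm z\<close>
  (that is, \<^const>\<open>sgn\<close>; the exceptional point \<open>0\<close> is a null set). It is a probability measure
  (\<open>prob_space_sphere_measure\<close>) and is invariant under all orthogonal transformations
  (\<open>distr_sphere_measure_orthogonal\<close>).
\<close>
definition sphere_measure :: "(real^'n) measure" where
  "sphere_measure =
     restrict_space (distr (uniform_measure lborel (ball 0 1)) borel sgn) (sphere 0 1)"

lemma space_sphere_measure [simp]: "space sphere_measure = sphere 0 1"
  by (simp add: sphere_measure_def space_restrict_space)

lemma sets_sphere_measure [measurable_cong]: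
  "sets sphere_measure = sets (restrict_space borel (sphere 0 1))"
  unfolding sphere_measure_def by (intro sets_restrict_space_cong) simp

lemma measurable_sgn_vec [measurable]: "(sgn :: real^'n \<Rightarrow> real^'n) \<in> borel_measurable borel"
  unfolding sgn_div_norm[abs_def] by measurable

lemma emeasure_sphere_measure:
  fixes B :: "(real^'n) set"
  assumes "B \<in> sets borel" "B \<subseteq> sphere 0 1"
  shows "emeasure sphere_measure B =
           emeasure lborel (ball 0 1 \<inter> sgn -` B) / emeasure lborel (ball (0::real^'n) 1)"
proof -
  have "sgn -` B \<in> sets borel"
    using measurable_sets[OF measurable_sgn_vec assms(1)] by simp
  then show ?thesis
    using assms by (simp add: sphere_measure_def emeasure_restrict_space emeasure_distr)
qed

lemma emeasure_lborel_unit_ball: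
  "emeasure lborel (ball (0::'a::euclidean_space) 1) \<noteq> 0"
  "emeasure lborel (ball (0::'a) 1) \<noteq> \<infinity>"
proof -
  show "emeasure lborel (ball (0::'a) 1) \<noteq> 0"
    using unit_ball_vol_pos[of "real DIM('a)", OF of_nat_0_le_iff] by (simp add: emeasure_ball del: unit_ball_vol_pos)
  show "emeasure lborel (ball (0::'a) 1) \<noteq> \<infinity>"
    using emeasure_lborel_ball_finite[of "0::'a" 1] by simp
qed

lemma prob_space_sphere_measure: "prob_space (sphere_measure :: (real^'n) measure)"
proof
  let ?B = "ball (0::real^'n) 1"
  have "emeasure lborel (?B \<inter> sgn -` sphere 0 1) = emeasure lborel (?B - {0})"
    by (rule arg_cong[where f = "emeasure lborel"]) (auto simp: norm_sgn)
  also have "\<dots> = emeasure lborel ?B"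
    by (intro emeasure_Diff_null_set) auto
  finally have "emeasure sphere_measure (sphere (0::real^'n) 1)
      = emeasure lborel ?B / emeasure lborel ?B"
    by (simp add: emeasure_sphere_measure)
  then show "emeasure sphere_measure (space (sphere_measure :: (real^'n) measure)) = 1"
    using emeasure_lborel_unit_ball[where 'a = "real^'n"] by (simp add: ennreal_divide_self less_top)
qed

lemma nn_integral_lborel_translate:
  fixes g :: "'a::euclidean_space \<Rightarrow> ennreal"
  assumes [measurable]: "g \<in> borel_measurable borel"
  shows "(\<integral>\<^sup>+ y. g (a + y) \<partial>lborel) = (\<integral>\<^sup>+ y. g y \<partial>lborel)"
  by (subst (2) lborel_distr_plus[of a, symmetric]) (simp add: nn_integral_distr)

lemma emeasure_lborel_orthogonal_vimage:
  fixes f :: "'a::euclidean_space \<Rightarrow> 'a"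
  assumes f: "orthogonal_transformation f" and A: "A \<in> sets borel"
  shows "emeasure lborel (f -` A) = emeasure lborel A"
proof -
  let ?B = "ball (0::'a) 1"
  have lin: "linear f" and nf: "\<And>x. norm (f x) = norm x"
    using f by (auto simp: orthogonal_transformation_linear orthogonal_transformation_norm)
  have fb [measurable]: "f \<in> borel_measurable borel"
    by (intro borel_measurable_continuous_onI linear_continuous_on linear_linear[THEN iffD2] lin)
  have finv: "f (inv f y) = y" for y
    using orthogonal_transformation_surj[OF f] by (simp add: surj_f_inv_f)
  have B: "?B \<in> sets borel" by simp
  note [measurable] = A B
  have 1: "(\<integral>\<^sup>+ x. (\<integral>\<^sup>+ y. indicator A (f x) * indicator ?B (- f x + y) \<partial>lborel) \<partial>lborel)
      = emeasure lborel (f -` A) * emeasure lborel ?B"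
  proof -
    have "(\<integral>\<^sup>+ y. indicator A (f x) * indicator ?B (- f x + y) \<partial>lborel)
        = indicator (f -` A) x * emeasure lborel ?B" for x
      by (subst nn_integral_cmult, measurable)
         (subst nn_integral_lborel_translate, auto simp: indicator_def)
    moreover have "f -` A \<in> sets borel" using measurable_sets[OF fb A] by simp
    ultimately show ?thesis by (simp add: nn_integral_multc)
  qed
  have 2: "(\<integral>\<^sup>+ x. indicator A (f x) * indicator ?B (- f x + y) \<partial>lborel)
      = (\<integral>\<^sup>+ x. indicator A (f x + y) * indicator ?B x \<partial>lborel)" for y
  proof -
    have "(\<integral>\<^sup>+ x. indicator A (f x) * indicator ?B (- f x + y) \<partial>lborel)
        = (\<integral>\<^sup>+ x. indicator A (f (inv f y + x)) * indicator ?B (- f (inv f y + x) + y) \<partial>lborel)"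
      by (subst nn_integral_lborel_translate
            [where g = "\<lambda>x. indicator A (f x) * indicator ?B (- f x + y)"]) auto
    also have "\<dots> = (\<integral>\<^sup>+ x. indicator A (f x + y) * indicator ?B x \<partial>lborel)"
      by (intro nn_integral_cong) (auto simp: linear_add[OF lin] finv nf add.commute indicator_def)
    finally show ?thesis .
  qed
  have "emeasure lborel (f -` A) * emeasure lborel ?B
      = (\<integral>\<^sup>+ y. (\<integral>\<^sup>+ x. indicator A (f x) * indicator ?B (- f x + y) \<partial>lborel) \<partial>lborel)"
    unfolding 1[symmetric] by (rule lborel_pair.Fubini') measurable
  also have "\<dots> = (\<integral>\<^sup>+ y. (\<integral>\<^sup>+ x. indicator A (f x + y) * indicator ?B x \<partial>lborel) \<partial>lborel)"
    by (simp only: 2)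
  also have "\<dots> = (\<integral>\<^sup>+ x. (\<integral>\<^sup>+ y. indicator A (f x + y) * indicator ?B x \<partial>lborel) \<partial>lborel)"
    by (rule lborel_pair.Fubini') measurable
  also have "\<dots> = (\<integral>\<^sup>+ x. emeasure lborel A * indicator ?B x \<partial>lborel)"
    by (subst nn_integral_multc, measurable)
       (subst nn_integral_lborel_translate, auto)
  also have "\<dots> = emeasure lborel A * emeasure lborel ?B"
    by (simp add: nn_integral_cmult)
  finally have "emeasure lborel (f -` A) * emeasure lborel ?B
      = emeasure lborel A * emeasure lborel ?B" .
  then show ?thesis
    using emeasure_lborel_unit_ball[where 'a = 'a]
    by (metis ennreal_mult_divide_eq infinity_ennreal_def)
qed

lemma distr_sphere_measure_orthogonal:
  fixes f :: "real^'n \<Rightarrow> real^'n"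
  assumes f: "orthogonal_transformation f"
  shows "distr sphere_measure sphere_measure f = sphere_measure"
proof (rule measure_eqI)
  have lin: "linear f" and nf: "\<And>x. norm (f x) = norm x"
    using f by (auto simp: orthogonal_transformation_linear orthogonal_transformation_norm)
  have fb: "f \<in> borel_measurable borel"
    by (intro borel_measurable_continuous_onI linear_continuous_on linear_linear[THEN iffD2] lin)
  have m: "f \<in> measurable sphere_measure sphere_measure"
    unfolding measurable_cong_sets[OF sets_sphere_measure sets_sphere_measure]
    by (intro measurable_restrict_space3 fb) (auto simp: nf)
  fix A assume "A \<in> sets (distr sphere_measure sphere_measure f)"
  then have A: "A \<in> sets sphere_measure" by simp
  then have A': "A \<in> sets borel" "A \<subseteq> sphere 0 1"
    by (auto simp: sets_sphere_measure sets_restrict_space)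
  define S where "S = ball 0 1 \<inter> sgn -` A"
  have S: "S \<in> sets borel"
    using measurable_sets[OF measurable_sgn_vec A'(1)] by (auto simp: S_def)
  have fA: "f -` A \<in> sets borel" "f -` A \<subseteq> sphere 0 1"
    using measurable_sets[OF fb A'(1)] A'(2) by (auto simp: nf subset_eq)
  have sgnf: "sgn (f x) = f (sgn x)" for x
    by (simp add: sgn_div_norm nf linear_cmul[OF lin])
  have eq: "ball 0 1 \<inter> sgn -` (f -` A) = f -` S"
    by (auto simp: S_def sgnf nf)
  have "f -` A \<inter> sphere 0 1 = f -` A" using fA by auto
  then show "emeasure (distr sphere_measure sphere_measure f) A = emeasure sphere_measure A"
    using A A' fA emeasure_lborel_orthogonal_vimage[OF f S]
    by (simp add: emeasure_distr[OF m] emeasure_sphere_measure eq S_def)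
qed simp


definition slab :: "real \<Rightarrow> real^'n \<Rightarrow> real \<Rightarrow> int \<Rightarrow> (real^'n) set" where
  "slab x u \<mu> j = {z. \<mu> * (of_int j + x) \<le> z \<bullet> u \<and> z \<bullet> u \<le> \<mu> * (of_int j + 1 + x)}"

definition width :: "real^'n \<Rightarrow> (real^'n) set \<Rightarrow> real" where
  "width u A = diameter ((\<lambda>z. z \<bullet> u) ` A)"

definition slab_components ::
    "'a::metric_space set \<Rightarrow> ('a \<Rightarrow> real^'n) \<Rightarrow> real \<Rightarrow> real^'n \<Rightarrow> real \<Rightarrow> 'a set set" where
  "slab_components X \<gamma> x u \<mu> =
     {C. (\<exists>j. C \<in> components {p \<in> X. \<gamma> p \<in> slab x u \<mu> j}) \<and> width u (\<gamma> ` C) > 0}"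

definition decreasing_enumeration ::
    "('c \<Rightarrow> real) \<Rightarrow> 'c set \<Rightarrow> nat set \<Rightarrow> (nat \<Rightarrow> 'c) \<Rightarrow> bool" where
  "decreasing_enumeration w K I C \<longleftrightarrow>
     (I = UNIV \<or> (\<exists>m. I = {..<m})) \<and> bij_betw C I K \<and>
     (\<forall>k. Suc k \<in> I \<longrightarrow> w (C (Suc k)) \<le> w (C k))"

definition slab_length ::
    "'a::metric_space set \<Rightarrow> ('a \<Rightarrow> real^'n) \<Rightarrow> real \<Rightarrow> real^'n \<Rightarrow> real \<Rightarrow> real" where
  "slab_length X \<gamma> x u \<mu> =
     (THE s. \<exists>I C. decreasing_enumeration (\<lambda>C. width u (\<gamma> ` C)) (slab_components X \<gamma> x u \<mu>) I C \<and>
        s = (\<Sum>k. if k \<in> I then (1/2) ^ k * width u (\<gamma> ` C k) else 0))"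

text \<open>
  The value of \<^const>\<open>slab_length\<close> does not depend on how ties are broken in the
  enumeration, so at most one number satisfies its description. For a generalized path and
  \<open>\<mu> > 0\<close> an enumeration exists, since local connectedness leaves only finitely many
  components of width at least any given \<open>\<epsilon> > 0\<close>.
\<close>
lemma decreasing_enumeration_le:
  assumes D: "decreasing_enumeration w K I C" and D': "decreasing_enumeration w K I' C'"
    and pos: "\<And>c. c \<in> K \<Longrightarrow> w c > (0::real)"
  shows "(if k \<in> I then w (C k) else 0) \<le> (if k \<in> I' then w (C' k) else 0)"
proof (rule ccontr)
  assume "\<not> ?thesis"
  then have less: "(if k \<in> I' then w (C' k) else 0) < (if k \<in> I then w (C k) else 0)" by simp
  have bij: "bij_betw C I K" "bij_betw C' I' K"
    using D D' by (auto simp: decreasing_enumeration_def)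
  have down: "i \<in> I" if "i \<le> j" "j \<in> I" for i j
    using D that by (auto simp: decreasing_enumeration_def)
  have down': "i \<in> I'" if "i \<le> j" "j \<in> I'" for i j
    using D' that by (auto simp: decreasing_enumeration_def)
  have dec: "w (C j) \<le> w (C i)" if "i \<le> j" "j \<in> I" for i j
    using that
  proof (induction j rule: dec_induct)
    case (step n)
    have "w (C (Suc n)) \<le> w (C n)"
      using D step by (auto simp: decreasing_enumeration_def)
    moreover have "n \<in> I" using down[of n "Suc n"] step by simp
    ultimately show ?case using step by simp
  qed simp
  have dec': "w (C' j) \<le> w (C' i)" if "i \<le> j" "j \<in> I'" for i j
    using that
  proof (induction j rule: dec_induct)
    case (step n)
    have "w (C' (Suc n)) \<le> w (C' n)"
      using D' step by (auto simp: decreasing_enumeration_def)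
    moreover have "n \<in> I'" using down'[of n "Suc n"] step by simp
    ultimately show ?case using step by simp
  qed simp
  have K': "C' i \<in> K" if "i \<in> I'" for i using bij(2) that by (auto simp: bij_betw_def)
  have k: "k \<in> I"
  proof (rule ccontr)
    assume "k \<notin> I"
    then have "(if k \<in> I' then w (C' k) else 0) < 0" using less by simp
    then show False using pos[OF K'] by (smt (verit))
  qed
  define T where "T = C ` {..k}"
  have sub: "T \<subseteq> C' ` {..<k}"
  proof
    fix c assume "c \<in> T"
    then obtain i where i: "i \<le> k" "c = C i" by (auto simp: T_def)
    then have "i \<in> I" using down k by blast
    then have "c \<in> K" using i bij(1) by (auto simp: bij_betw_def)
    then obtain j where j: "j \<in> I'" "c = C' j" using bij(2) by (auto simp: bij_betw_def)
    have wc: "w (C k) \<le> w c" using dec[of i k] i k by simp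
    have "j < k"
    proof (rule ccontr)
      assume "\<not> j < k"
      then have "k \<in> I'" "w (C' j) \<le> w (C' k)" using down'[of k j] dec'[of k j] j by auto
      then show False using less k wc j by simp
    qed
    then show "c \<in> C' ` {..<k}" using j by auto
  qed
  have "inj_on C {..k}"
    using bij(1) down k by (meson atMost_iff bij_betw_imp_inj_on inj_on_subset subsetI)
  then have "card T = Suc k" by (simp add: T_def card_image)
  moreover have "card T \<le> card (C' ` {..<k})" using sub by (intro card_mono) auto
  moreover have "card (C' ` {..<k}) \<le> k" using card_image_le[of "{..<k}" C'] by simp
  ultimately show False by simp
qed

lemma slab_length_eqI:
  assumes D: "decreasing_enumeration (\<lambda>C. width u (\<gamma> ` C)) (slab_components X \<gamma> x u \<mu>) I C"
  shows "slab_length X \<gamma> x u \<mu> = (\<Sum>k. if k \<in> I then (1/2) ^ k * width u (\<gamma> ` C k) else 0)"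
  unfolding slab_length_def
proof (rule the_equality)
  fix s
  assume "\<exists>I C. decreasing_enumeration (\<lambda>C. width u (\<gamma> ` C)) (slab_components X \<gamma> x u \<mu>) I C \<and>
        s = (\<Sum>k. if k \<in> I then (1/2) ^ k * width u (\<gamma> ` C k) else 0)"
  then obtain J E
    where E: "decreasing_enumeration (\<lambda>C. width u (\<gamma> ` C)) (slab_components X \<gamma> x u \<mu>) J E"
      and s: "s = (\<Sum>k. if k \<in> J then (1/2) ^ k * width u (\<gamma> ` E k) else 0)" by blast
  have pos: "\<And>c. c \<in> slab_components X \<gamma> x u \<mu> \<Longrightarrow> width u (\<gamma> ` c) > 0"
    by (simp add: slab_components_def)
  have wk: "(if k \<in> J then width u (\<gamma> ` E k) else 0) = (if k \<in> I then width u (\<gamma> ` C k) else 0)" for k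
    by (intro antisym decreasing_enumeration_le[OF E D pos] decreasing_enumeration_le[OF D E pos])
  have "(if k \<in> J then (1/2) ^ k * width u (\<gamma> ` E k) else 0)
      = (if k \<in> I then (1/2) ^ k * width u (\<gamma> ` C k) else 0)" for k
    using wk[of k] by (cases "k \<in> J"; cases "k \<in> I") auto
  then show "s = (\<Sum>k. if k \<in> I then (1/2) ^ k * width u (\<gamma> ` C k) else 0)"
    unfolding s by simp
qed (use D in blast)

text \<open>
  The integrand is nonnegative, so the Lebesgue integral with values in \<^typ>\<open>ennreal\<close>
  is used; the result is finite because \<^const>\<open>slab_length\<close> is at most \<open>2\<close>.
\<close>
definition len :: "'a::metric_space set \<Rightarrow> ('a \<Rightarrow> real^'n) \<Rightarrow> ennreal" where
  "len X \<gamma> =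
     (\<integral>\<^sup>+ \<mu> \<in> {0<..1}. (\<integral>\<^sup>+ u. (\<integral>\<^sup>+ x \<in> {0..1}.
        ennreal (slab_length X \<gamma> x u \<mu>) \<partial>lborel) \<partial>sphere_measure) \<partial>lborel)"

end

theory Submission
  imports Defs
begin

text \<open>
  Parts (ii) and (iii) hold already for the integrand, up to a rotation of \<open>u\<close> and a translation of
  \<open>x\<close>. Nothing is claimed about measurability of the integrand, so the integrals are lower integrals:
  for (iii) one uses that these are invariant under every invertible measure-preserving map, and for
  (i) one bounds the integrand from below by a measurable function. If \<open>\<langle>\<gamma>, u\<rangle>\<close> oscillates by at least
  \<open>d\<close> and \<open>\<mu> \<le> d / 2\<close>, some slab lies inside the range of \<open>\<langle>\<gamma>, u\<rangle>\<close>; a component of its preimage through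
  a point of the middle hyperplane must reach the boundary of the slab, since otherwise local
  connectedness would make it open and closed in \<open>X\<close>. This component has width at least \<open>\<mu> / 2\<close>.
\<close>

section \<open>Existence of decreasing enumerations\<close>

text \<open>Rank each element by the number of elements preceding it, heavier ones first. Finiteness
  of the level sets makes the ranks finite, they fill an initial segment of the naturals, and the
  inverse of the ranking is the enumeration.\<close>

lemma ex_decreasing_enumeration:
  fixes w :: "'c \<Rightarrow> real"
  assumes fin: "\<And>\<epsilon>. \<epsilon> > 0 \<Longrightarrow> finite {c \<in> K. \<epsilon> \<le> w c}"
    and pos: "\<And>c. c \<in> K \<Longrightarrow> w c > 0"
  shows "\<exists>I C. decreasing_enumeration w K I C"
proof -
  have "\<exists>n. inverse (real (Suc n)) \<le> w c" if "c \<in> K" for c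
    using reals_Archimedean[OF pos[OF that]] less_imp_le by blast
  then have "K = (\<Union>n. {c \<in> K. inverse (real (Suc n)) \<le> w c})" by blast
  moreover have "countable (\<Union>n. {c \<in> K. inverse (real (Suc n)) \<le> w c})"
    by (rule countable_UN[OF _ countable_finite[OF fin]]) simp_all
  ultimately have "countable K" by simp
  \<comment> \<open>Countability of \<open>K\<close> provides an injection into the naturals, which
    breaks ties between equal weights.\<close>
  define e where "e = to_nat_on K"
  have inj: "inj_on e K"
    unfolding e_def using \<open>countable K\<close> by (rule inj_on_to_nat_on)
  define prec where "prec d c \<longleftrightarrow> w c < w d \<or> w c = w d \<and> e d < e c" for c d
  define P where "P c = {d \<in> K. prec d c}" for c
  define r where "r c = card (P c)" for c
  have finP: "finite (P c)" if "c \<in> K" for c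
    by (rule finite_subset[OF _ fin[OF pos[OF that]]]) (auto simp: P_def prec_def)
  have r_less: "r d < r c" if "prec d c" "c \<in> K" "d \<in> K" for c d
    unfolding r_def
  proof (rule psubset_card_mono[OF finP[OF that(2)]])
    show "P d \<subset> P c"
      using that by (auto simp: P_def prec_def)
  qed
  have total: "prec c d \<or> prec d c" if "c \<in> K" "d \<in> K" "c \<noteq> d" for c d
    using that inj by (auto simp: prec_def inj_on_def) (metis linorder_less_linear)
  have inj_r: "inj_on r K"
    using r_less total by (metis inj_onI less_irrefl)
  have down: "m \<in> r ` K" if "m < r c" "c \<in> K" for m c
  proof -
    have sub: "P c \<subseteq> K" by (auto simp: P_def)
    \<comment> \<open>The \<open>r c\<close> predecessors of \<open>c\<close> have distinct ranks
      below \<open>r c\<close>, so every smaller rank occurs.\<close>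
    have "r ` P c \<subseteq> {..<r c}"
      using r_less that(2) by (auto simp: P_def)
    moreover have "card (r ` P c) = card {..<r c}"
      using card_image[OF inj_on_subset[OF inj_r sub]] by (simp add: r_def)
    ultimately have "r ` P c = {..<r c}" by (intro card_subset_eq) auto
    then show ?thesis using that(1) sub by blast
  qed
  have initial: "r ` K = UNIV \<or> (\<exists>m. r ` K = {..<m})"
  proof (cases "finite (r ` K)")
    case True
    show ?thesis
    proof (cases "K = {}")
      case False
      then have "Max (r ` K) \<in> r ` K" using True by (intro Max_in) auto
      then obtain c where c: "c \<in> K" "r c = Max (r ` K)" by (metis imageE)
      have "r ` K = {..r c}"
      proof (intro equalityI subsetI)
        fix m assume "m \<in> r ` K"
        then show "m \<in> {..r c}" using True by (simp add: c(2))
      next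
        fix m assume "m \<in> {..r c}"
        then show "m \<in> r ` K" using down[of m c] c(1) by (cases "m = r c") auto
      qed
      then have "r ` K = {..<Suc (r c)}" by (simp add: lessThan_Suc_atMost)
      then show ?thesis by blast
    qed auto
  next
    case False
    then show ?thesis
      using down by (metis (no_types, lifting) UNIV_eq_I imageE infinite_nat_iff_unbounded)
  qed
  define C where "C = inv_into K r"
  have C: "C k \<in> K" "r (C k) = k" if "k \<in> r ` K" for k
    using that by (auto simp: C_def inv_into_into f_inv_into_f)
  have "bij_betw C (r ` K) K"
    unfolding C_def by (intro bij_betw_inv_into) (simp add: bij_betw_def inj_r)
  moreover have "w (C (Suc k)) \<le> w (C k)" if "Suc k \<in> r ` K" for k
  proof (rule ccontr)
    have k: "k \<in> r ` K" using that down by (metis imageE lessI)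
    assume "\<not> ?thesis"
    then have "prec (C (Suc k)) (C k)" by (simp add: prec_def)
    then have "r (C (Suc k)) < r (C k)" using r_less C that k by blast
    then show False using C that k by simp
  qed
  ultimately have "decreasing_enumeration w K (r ` K) C"
    using initial by (simp add: decreasing_enumeration_def)
  then show ?thesis by blast
qed

section \<open>Components of preimages of slabs\<close>

lemma width_image: "width u (\<gamma> ` C) = diameter ((\<lambda>p. \<gamma> p \<bullet> u) ` C)"
  by (simp add: width_def image_image)

context
  fixes X :: "'a::metric_space set" and \<gamma> :: "'a \<Rightarrow> real^'n"
  assumes path: "generalized_path X \<gamma>"
begin

lemma continuous_on_inner_path: "continuous_on X (\<lambda>p. \<gamma> p \<bullet> u)"
  using path by (auto simp: generalized_path_def intro!: continuous_intros)

lemma bounded_inner_path: "C \<subseteq> X \<Longrightarrow> bounded ((\<lambda>p. \<gamma> p \<bullet> u) ` C)"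
  using path continuous_on_inner_path[of u]
  by (meson bounded_subset compact_continuous_image compact_imp_bounded continuum_def
      generalized_path_def image_mono)

text \<open>By compactness, finitely many connected relatively open sets on which \<langle>\<gamma>,
  u\<rangle> oscillates by less than \<open>\<epsilon> / 3\<close> cover \<open>X\<close>. Each wide
  component contains one of them entirely, and that set determines the component.\<close>

lemma finite_wide_components:
  assumes "\<epsilon> > 0"
  shows "finite {C \<in> slab_components X \<gamma> x u \<mu>. \<epsilon> \<le> width u (\<gamma> ` C)}" (is "finite ?S")
proof -
  define f where "f p = \<gamma> p \<bullet> u" for p
  define F where "F j = {p \<in> X. \<gamma> p \<in> slab x u \<mu> j}" for j
  have F: "F j = {p \<in> X. \<mu> * (of_int j + x) \<le> f p \<and> f p \<le> \<mu> * (of_int j + 1 + x)}" for j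
    by (auto simp: F_def slab_def f_def)
  have cont: "continuous_on X f"
    unfolding f_def by (rule continuous_on_inner_path)
  define \<V> where "\<V> = {V. openin (top_of_set X) V \<and> connected V \<and> (\<forall>p\<in>V. \<forall>q\<in>V. \<bar>f p - f q\<bar> < \<epsilon> / 3)}"
  have "X \<subseteq> \<Union>\<V>"
  proof
    fix p assume p: "p \<in> X"
    have "openin (top_of_set X) (X \<inter> f -` ball (f p) (\<epsilon> / 6))"
      by (intro continuous_openin_preimage_gen cont) simp
    moreover have "p \<in> X \<inter> f -` ball (f p) (\<epsilon> / 6)" using p assms by simp
    moreover have "locally connected X" using path by (simp add: generalized_path_def)
    ultimately obtain V where V: "openin (top_of_set X) V" "connected V" "p \<in> V"
        "V \<subseteq> X \<inter> f -` ball (f p) (\<epsilon> / 6)"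
      by (meson locally_connected)
    have "\<bar>f q - f q'\<bar> < \<epsilon> / 3" if "q \<in> V" "q' \<in> V" for q q'
    proof -
      have "\<bar>f p - f q\<bar> < \<epsilon> / 6" "\<bar>f p - f q'\<bar> < \<epsilon> / 6"
        using that V(4) by (auto simp: dist_real_def)
      then show ?thesis by linarith
    qed
    then show "p \<in> \<Union>\<V>" using V by (auto simp: \<V>_def)
  qed
  moreover have "compact X" using path by (simp add: generalized_path_def continuum_def)
  moreover have "\<forall>V\<in>\<V>. openin (top_of_set X) V" by (simp add: \<V>_def)
  ultimately obtain D where D: "D \<subseteq> \<V>" "finite D" "X \<subseteq> \<Union>D"
    by (metis compact_eq_openin_cover)
  \<comment> \<open>The point \<open>m\<close> makes \<open>C\<close> recoverable from
    \<open>V\<close>: lying strictly inside slab \<open>j\<close>, it belongs to no other slab, and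
    \<open>C\<close> is the component containing it.\<close>
  define Q where "Q C V \<longleftrightarrow> V \<in> D \<and> V \<subseteq> C \<and> (\<exists>j. C \<in> components (F j) \<and>
      (\<exists>m\<in>V. \<mu> * (of_int j + x) < f m \<and> f m < \<mu> * (of_int j + 1 + x)))" for C V
  have "\<exists>V. Q C V" if C: "C \<in> ?S" for C
  proof -
    obtain j where j: "C \<in> components (F j)" and wide: "\<epsilon> \<le> diameter (f ` C)"
      using C by (auto simp: slab_components_def F_def width_image f_def)
    have CF: "C \<subseteq> F j" and CX: "C \<subseteq> X" and conn: "connected C"
      using j in_components_subset in_components_connected by (auto simp: F_def)
    \<comment> \<open>The factor \<open>2 / 3\<close> leaves more than \<open>\<epsilon> / 3\<close>
      on either side of the midpoint of the two values, so a cover set around a point with the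
      midpoint value stays between \<open>f a\<close> and \<open>f b\<close>.\<close>
    have "\<exists>y\<in>f ` C. \<exists>z\<in>f ` C. 2 / 3 * \<epsilon> < dist y z"
      using wide assms bounded_inner_path[OF CX] by (intro diameter_lower_bounded) (auto simp: f_def)
    then obtain a b where ab: "a \<in> C" "b \<in> C" "2 / 3 * \<epsilon> < f b - f a"
      by (auto simp: dist_real_def abs_if split: if_splits)
    have "connected (f ` C)"
      using conn cont CX by (meson connected_continuous_image continuous_on_subset)
    then have "{f a..f b} \<subseteq> f ` C" using ab by (intro connected_contains_Icc) auto
    moreover have "(f a + f b) / 2 \<in> {f a..f b}" using ab assms by auto
    ultimately have "(f a + f b) / 2 \<in> f ` C" by (rule subsetD)
    then obtain m where m: "m \<in> C" "f m = (f a + f b) / 2" by (metis imageE)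
    obtain V where V: "V \<in> D" "m \<in> V" using D(3) m CX by blast
    have near: "f a < f q \<and> f q < f b" if "q \<in> V" for q
    proof -
      have "\<bar>f q - f m\<bar> < \<epsilon> / 3" using V that D(1) by (auto simp: \<V>_def)
      then have "f q - f m < \<epsilon> / 3" "f m - f q < \<epsilon> / 3"
        unfolding abs_less_iff by auto
      then show ?thesis using ab(3) m(2) by (simp add: field_simps)
    qed
    have bounds: "\<mu> * (of_int j + x) \<le> f a" "f b \<le> \<mu> * (of_int j + 1 + x)"
      using ab CF by (auto simp: F)
    have VV: "openin (top_of_set X) V" "connected V" using V D(1) by (auto simp: \<V>_def)
    have "V \<subseteq> F j"
    proof
      fix q assume "q \<in> V"
      then show "q \<in> F j"
        using near[of q] bounds openin_imp_subset[OF VV(1)] by (auto simp: F)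
    qed
    then have "V \<subseteq> C"
      using components_maximal[OF j VV(2)] m V by blast
    moreover have "\<mu> * (of_int j + x) < f m" "f m < \<mu> * (of_int j + 1 + x)"
      using near[OF V(2)] bounds by linarith+
    ultimately show ?thesis unfolding Q_def using V j by blast
  qed
  then obtain \<phi> where "\<And>C. C \<in> ?S \<Longrightarrow> Q C (\<phi> C)" by metis
  note \<phi> = this[unfolded Q_def]
  have "inj_on \<phi> ?S"
  proof (rule inj_onI)
    fix C C' assume S: "C \<in> ?S" "C' \<in> ?S" and eq: "\<phi> C = \<phi> C'"
    obtain j m where j: "C \<in> components (F j)" "m \<in> \<phi> C"
        "\<mu> * (of_int j + x) < f m" "f m < \<mu> * (of_int j + 1 + x)"
      using \<phi>[OF S(1)] by blast
    obtain j' where j': "C' \<in> components (F j')" using \<phi>[OF S(2)] by blast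
    have mC: "m \<in> C" "m \<in> C'" using \<phi> S eq j(2) by blast+
    then have "m \<in> F j'" using j' in_components_subset by blast
    then have m': "\<mu> * (of_int j' + x) \<le> f m" "f m \<le> \<mu> * (of_int j' + 1 + x)" by (auto simp: F)
    \<comment> \<open>Positivity of \<open>\<mu>\<close> is read off from the strict bounds on
      \<open>f m\<close>; cancelling it shows that the two slabs have the same index.\<close>
    have "\<mu> * (of_int j + x) < \<mu> * (of_int j + 1 + x)" using j by linarith
    then have "\<mu> > 0" by (simp add: algebra_simps)
    have "\<mu> * (of_int j + x) < \<mu> * (of_int j' + 1 + x)" "\<mu> * (of_int j' + x) < \<mu> * (of_int j + 1 + x)"
      using j m' by linarith+
    then have "j = j'" using \<open>\<mu> > 0\<close> by (simp add: mult_less_cancel_left)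
    then show "C = C'" using j(1) j' mC components_nonoverlap by blast
  qed
  moreover have "finite (\<phi> ` ?S)" using \<phi> D(2) by (auto intro: finite_subset)
  ultimately show ?thesis using finite_imageD by blast
qed

lemma ex_slab_enumeration:
  "\<exists>I C. decreasing_enumeration (\<lambda>C. width u (\<gamma> ` C)) (slab_components X \<gamma> x u \<mu>) I C"
  by (intro ex_decreasing_enumeration finite_wide_components) (auto simp: slab_components_def)

text \<open>The leading term of the series is the largest width, with coefficient 1, and all other
  terms are nonnegative.\<close>

lemma width_le_slab_length:
  assumes "C \<in> slab_components X \<gamma> x u \<mu>"
  shows "width u (\<gamma> ` C) \<le> slab_length X \<gamma> x u \<mu>"
proof -
  let ?w = "\<lambda>C. width u (\<gamma> ` C)" and ?K = "slab_components X \<gamma> x u \<mu>"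
  obtain I D where D: "decreasing_enumeration ?w ?K I D" using ex_slab_enumeration by blast
  define t where "t k = (if k \<in> I then (1/2) ^ k * ?w (D k) else 0)" for k
  have down: "i \<in> I" if "i \<le> j" "j \<in> I" for i j
    using D that by (auto simp: decreasing_enumeration_def)
  have first: "?w (D k) \<le> ?w (D 0)" if "k \<in> I" for k
    using that
  proof (induction k)
    case (Suc k)
    have "?w (D (Suc k)) \<le> ?w (D k)"
      using D Suc.prems by (simp add: decreasing_enumeration_def)
    then show ?case using Suc.IH down[of k "Suc k"] Suc.prems by simp
  qed simp
  have pos: "0 < ?w (D k)" if "k \<in> I" for k
    using D that by (auto simp: decreasing_enumeration_def bij_betw_def slab_components_def)
  obtain k where k: "k \<in> I" "C = D k"
    using D assms unfolding decreasing_enumeration_def bij_betw_def by (metis imageE)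
  have t0: "t k \<ge> 0" for k
    by (auto simp: t_def intro!: mult_nonneg_nonneg less_imp_le[OF pos])
  have w0: "0 < ?w (D 0)" using first[OF k(1)] pos[OF k(1)] by linarith
  \<comment> \<open>Comparison with a geometric series gives summability, so that the infinite sum
    dominates its partial sums.\<close>
  have "norm (t k) \<le> ?w (D 0) * (1/2) ^ k" for k
    using first[of k] pos[of k] w0 by (auto simp: t_def abs_mult mult.commute intro!: mult_right_mono)
  then have "summable t"
    by (intro summable_comparison_test'[OF summable_mult[OF summable_geometric[of "1/2::real"]]]) auto
  then have "sum t {0} \<le> suminf t" by (intro sum_le_suminf) (use t0 in auto)
  moreover have "t 0 = ?w (D 0)" using down[of 0 k] k by (simp add: t_def)
  ultimately show ?thesis
    using first[OF k(1)] k by (simp add: slab_length_eqI[OF D] t_def[symmetric])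
qed

text \<open>A component avoiding both boundary values is also a component of the relatively open set
  where the projection lies strictly between \<open>a\<close> and \<open>b\<close>, so it is open by
  local connectedness. As a component of a closed set it is closed, and connectedness of
  \<open>X\<close> leaves only \<open>C = X\<close>.\<close>

lemma slab_component_meets_boundary:
  fixes u :: "real^'n"
  assumes C: "C \<in> components {p \<in> X. a \<le> \<gamma> p \<bullet> u \<and> \<gamma> p \<bullet> u \<le> b}" and ne: "C \<noteq> X"
  shows "\<exists>p\<in>C. \<gamma> p \<bullet> u = a \<or> \<gamma> p \<bullet> u = b"
proof (rule ccontr)
  define f where "f p = \<gamma> p \<bullet> u" for p
  define F where "F = {p \<in> X. a \<le> f p \<and> f p \<le> b}"
  define G where "G = X \<inter> f -` {a<..<b}"
  assume "\<not> ?thesis"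
  then have noteq: "\<forall>p\<in>C. f p \<noteq> a \<and> f p \<noteq> b" by (simp add: f_def)
  have CF: "C \<in> components F" using C by (simp add: F_def f_def)
  have cont: "continuous_on X f"
    unfolding f_def by (rule continuous_on_inner_path)
  have "C \<subseteq> G"
    using in_components_subset[OF CF] noteq by (force simp: F_def G_def)
  moreover have "G \<subseteq> F" by (auto simp: F_def G_def)
  ultimately have "C \<in> components G" using components_intermediate_subset CF by blast
  moreover have "openin (top_of_set X) G"
    unfolding G_def by (intro continuous_openin_preimage_gen cont) simp
  ultimately have "openin (top_of_set X) C"
    using path locally_connected_open_component by (auto simp: generalized_path_def)
  moreover have "closedin (top_of_set X) C"
  proof (rule closedin_trans[OF closedin_component[OF CF]])
    have "F = X \<inter> f -` {a..b}" by (auto simp: F_def)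
    then show "closedin (top_of_set X) F" using continuous_closedin_preimage[OF cont] by simp
  qed
  moreover have "connected X" using path by (simp add: generalized_path_def continuum_def)
  ultimately show False
    using ne in_components_nonempty[OF CF] connected_clopen by blast
qed

text \<open>The bound does not depend on the offset \<open>x\<close>; this uniformity helps to
  produce a measurable minorant of the integrand.\<close>

lemma slab_length_lower_bound:
  assumes pq: "p \<in> X" "q \<in> X" and \<mu>: "0 < \<mu>" "2 * \<mu> \<le> \<gamma> p \<bullet> u - \<gamma> q \<bullet> u"
  shows "\<mu> / 2 \<le> slab_length X \<gamma> x u \<mu>"
proof -
  define f where "f p = \<gamma> p \<bullet> u" for p
  \<comment> \<open>This is the first slab starting at or above \<open>f q\<close>. It starts less
    than \<open>\<mu>\<close> higher, so it ends below \<open>f q + 2 * \<mu>\<close> and hence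
    below \<open>f p\<close>.\<close>
  define j where "j = \<lceil>f q / \<mu> - x\<rceil>"
  define a b where "a = \<mu> * (of_int j + x)" and "b = \<mu> * (of_int j + 1 + x)"
  have "f q / \<mu> \<le> of_int j + x" "of_int j + x < f q / \<mu> + 1" unfolding j_def by linarith+
  then have a: "f q \<le> a" "a < f q + \<mu>"
    using \<mu>(1) by (simp_all add: a_def field_simps)
  have b: "b = a + \<mu>" by (simp add: a_def b_def algebra_simps)
  define F where "F = {p \<in> X. a \<le> f p \<and> f p \<le> b}"
  have "connected (f ` X)"
    using path continuous_on_inner_path unfolding f_def
    by (intro connected_continuous_image) (auto simp: generalized_path_def continuum_def)
  then have "{f q..f p} \<subseteq> f ` X" using pq by (intro connected_contains_Icc) auto
  moreover have "a + \<mu> / 2 \<in> {f q..f p}" using a \<mu> by (simp add: f_def)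
  ultimately have "a + \<mu> / 2 \<in> f ` X" by (rule subsetD)
  then obtain m where m: "m \<in> X" "f m = a + \<mu> / 2" by (metis imageE)
  define C where "C = connected_component_set F m"
  have "m \<in> F" using m \<mu> b by (simp add: F_def)
  then have C: "C \<in> components F" "m \<in> C" by (auto simp: C_def componentsI)
  have "p \<notin> F" using a b \<mu> by (auto simp: F_def f_def)
  then have "C \<noteq> X" using in_components_subset[OF C(1)] pq by blast
  then obtain e where e: "e \<in> C" "f e = a \<or> f e = b"
    using slab_component_meets_boundary[of C a u b] C by (auto simp: F_def f_def)
  have "C \<subseteq> X" using in_components_subset[OF C(1)] by (auto simp: F_def)
  \<comment> \<open>Between the boundary point \<open>e\<close> and the point \<open>m\<close> of
    the middle hyperplane, \<open>f\<close> changes by exactly \<open>\<mu> / 2\<close>.\<close>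
  then have "dist (f e) (f m) \<le> width u (\<gamma> ` C)"
    using bounded_inner_path[of C u] e C unfolding width_image f_def
    by (intro diameter_bounded_bound) auto
  then have width: "\<mu> / 2 \<le> width u (\<gamma> ` C)"
    using e m b \<mu> by (auto simp: dist_real_def)
  have "F = {p \<in> X. \<gamma> p \<in> slab x u \<mu> j}"
    by (auto simp: F_def slab_def f_def a_def b_def)
  then have "C \<in> slab_components X \<gamma> x u \<mu>"
    using C width \<mu> by (auto simp: slab_components_def)
  then show ?thesis using width_le_slab_length width by force
qed

end

lemma slab_length_constant:
  assumes "\<gamma> constant_on X"
  shows "slab_length X \<gamma> x u \<mu> = 0"
proof -
  obtain z where z: "\<And>p. p \<in> X \<Longrightarrow> \<gamma> p = z" using assms by (auto simp: constant_on_def)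
  have "width u (\<gamma> ` C) = 0" if "C \<subseteq> X" for C
  proof -
    have "\<gamma> ` C = {} \<or> \<gamma> ` C = {z}" using z that by blast
    then show ?thesis by (auto simp: width_def)
  qed
  moreover have "C \<subseteq> X" if "C \<in> slab_components X \<gamma> x u \<mu>" for C
    using that in_components_subset by (fastforce simp: slab_components_def)
  moreover have "width u (\<gamma> ` C) > 0" if "C \<in> slab_components X \<gamma> x u \<mu>" for C
    using that by (simp add: slab_components_def)
  ultimately have "slab_components X \<gamma> x u \<mu> = {}"
    by (metis all_not_in_conv less_irrefl)
  \<comment> \<open>The index set is \<open>{..<0}\<close>, and any function is a bijection from it
    onto the empty set.\<close>
  then have "decreasing_enumeration (\<lambda>C. width u (\<gamma> ` C)) (slab_components X \<gamma> x u \<mu>) {} undefined"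
    by (auto simp: decreasing_enumeration_def bij_betw_def intro: exI[of _ 0])
  from slab_length_eqI[OF this] show ?thesis by simp
qed

section \<open>Symmetries of the integrand\<close>

lemma components_homeomorphism:
  assumes "homeomorphism S T f g" "C \<in> components S"
  shows "f ` C \<in> components T"
  using assms connected_component_set_homeomorphism[OF assms(1)] homeomorphism_image1[OF assms(1)]
  by (auto simp: components_iff)

lemma slab_components_homeomorphism:
  assumes h: "homeomorphism Y X h g" and C: "C \<in> slab_components Y (\<gamma> \<circ> h) x u \<mu>"
  shows "h ` C \<in> slab_components X \<gamma> x u \<mu>"
proof -
  obtain j where j: "C \<in> components {p \<in> Y. (\<gamma> \<circ> h) p \<in> slab x u \<mu> j}"
    using C by (auto simp: slab_components_def)
  have "h ` {p \<in> Y. (\<gamma> \<circ> h) p \<in> slab x u \<mu> j} = {p \<in> X. \<gamma> p \<in> slab x u \<mu> j}"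
    using homeomorphism_image1[OF h] by auto
  then have "homeomorphism {p \<in> Y. (\<gamma> \<circ> h) p \<in> slab x u \<mu> j} {p \<in> X. \<gamma> p \<in> slab x u \<mu> j} h g"
    by (intro homeomorphism_of_subsets[OF h]) auto
  from components_homeomorphism[OF this j] show ?thesis
    using C by (auto simp: slab_components_def image_comp)
qed

lemma slab_length_homeomorphism:
  fixes X :: "'a::metric_space set" and Y :: "'b::metric_space set"
  assumes path: "generalized_path X \<gamma>" and h: "homeomorphism Y X h g"
  shows "slab_length Y (\<gamma> \<circ> h) x u \<mu> = slab_length X \<gamma> x u \<mu>"
proof -
  let ?K = "slab_components X \<gamma> x u \<mu>" and ?L = "slab_components Y (\<gamma> \<circ> h) x u \<mu>"
  obtain I D where D: "decreasing_enumeration (\<lambda>C. width u (\<gamma> ` C)) ?K I D"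
    using ex_slab_enumeration[OF path] by blast
  have g: "homeomorphism X Y g h" using h by (rule homeomorphism_sym[THEN iffD1])
  have sub: "C \<subseteq> X" if "C \<in> ?K" for C
    using that in_components_subset by (fastforce simp: slab_components_def)
  have sub': "C \<subseteq> Y" if "C \<in> ?L" for C
    using that in_components_subset by (fastforce simp: slab_components_def)
  have hg: "h ` g ` C = C" if "C \<in> ?K" for C
    using sub[OF that] homeomorphism_apply2[OF h] by (force simp: image_image)
  have gh: "g ` h ` C = C" if "C \<in> ?L" for C
    using sub'[OF that] homeomorphism_apply1[OF h] by (force simp: image_image)
  \<comment> \<open>Applied to \<open>g\<close>, the preceding lemma would speak of
    \<open>\<gamma> \<circ> h \<circ> g\<close>, which is only known to agree with
    \<open>\<gamma>\<close> on \<open>X\<close>; hence the direct argument.\<close>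
  have gK: "g ` C \<in> ?L" if C: "C \<in> ?K" for C
  proof -
    obtain j where j: "C \<in> components {p \<in> X. \<gamma> p \<in> slab x u \<mu> j}"
      using C by (auto simp: slab_components_def)
    have "g ` {p \<in> X. \<gamma> p \<in> slab x u \<mu> j} = {p \<in> Y. (\<gamma> \<circ> h) p \<in> slab x u \<mu> j}"
      using g h by (force simp: homeomorphism_def)
    then have "homeomorphism {p \<in> X. \<gamma> p \<in> slab x u \<mu> j} {p \<in> Y. (\<gamma> \<circ> h) p \<in> slab x u \<mu> j} g h"
      by (intro homeomorphism_of_subsets[OF g]) auto
    from components_homeomorphism[OF this j]
    have "g ` C \<in> components {p \<in> Y. (\<gamma> \<circ> h) p \<in> slab x u \<mu> j}" .
    moreover have "width u ((\<gamma> \<circ> h) ` g ` C) > 0"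
      unfolding image_comp[symmetric, of \<gamma> h] hg[OF C] using C by (simp add: slab_components_def)
    ultimately show ?thesis unfolding slab_components_def by blast
  qed
  have "bij_betw (image g) ?K ?L"
    using slab_components_homeomorphism[OF h] gK hg gh
    by (intro bij_betw_byWitness[where f' = "image h"]) auto
  then have bij: "bij_betw (image g \<circ> D) I ?L"
    using D by (auto simp: decreasing_enumeration_def intro: bij_betw_trans)
  have DK: "D k \<in> ?K" if "k \<in> I" for k
    using D that by (auto simp: decreasing_enumeration_def bij_betw_def)
  have w: "width u ((\<gamma> \<circ> h) ` (image g \<circ> D) k) = width u (\<gamma> ` D k)" if "k \<in> I" for k
    unfolding o_apply[of "image g"] image_comp[symmetric, of \<gamma> h] hg[OF DK[OF that]] ..
  have "decreasing_enumeration (\<lambda>C. width u ((\<gamma> \<circ> h) ` C)) ?L I (image g \<circ> D)"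
    unfolding decreasing_enumeration_def
  proof (intro conjI allI impI bij)
    show initial: "I = UNIV \<or> (\<exists>m. I = {..<m})" using D by (simp add: decreasing_enumeration_def)
    fix k assume k: "Suc k \<in> I"
    then have "k \<in> I" using initial by auto
    then show "width u ((\<gamma> \<circ> h) ` (image g \<circ> D) (Suc k)) \<le> width u ((\<gamma> \<circ> h) ` (image g \<circ> D) k)"
      using D k by (simp only: w) (simp add: decreasing_enumeration_def)
  qed
  from slab_length_eqI[OF this] show ?thesis
    unfolding slab_length_eqI[OF D] by (simp only: w cong: if_cong)
qed

lemma diameter_image_cong:
  assumes "\<And>p q. dist (f p) (f q) = dist (g p) (g q)"
  shows "diameter (f ` C) = diameter (g ` C)"
proof -
  have "(\<lambda>(x, y). dist x y) ` (f ` C \<times> f ` C) = (\<lambda>(p, q). dist (f p) (f q)) ` (C \<times> C)"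
    by force
  moreover have "(\<lambda>(x, y). dist x y) ` (g ` C \<times> g ` C) = (\<lambda>(p, q). dist (g p) (g q)) ` (C \<times> C)"
    by force
  ultimately show ?thesis by (simp add: diameter_def assms)
qed

text \<open>A constant \<open>c\<close> added to the projection is compensated by the offset, and
  the integer \<open>k\<close> merely renumbers the slabs. The case \<open>c = 0\<close> gives
  period 1 in \<open>x\<close>, the case \<open>k = 0\<close> the effect of an isometry.\<close>

lemma slab_length_affine:
  fixes \<gamma> \<gamma>' :: "'a::metric_space \<Rightarrow> real^'n"
  assumes shift: "\<And>p. \<gamma>' p \<bullet> u' = \<gamma> p \<bullet> u + c" and x': "\<mu> * x' = \<mu> * x + c + \<mu> * of_int k"
  shows "slab_length X \<gamma>' x' u' \<mu> = slab_length X \<gamma> x u \<mu>"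
proof -
  have w: "width u' (\<gamma>' ` C) = width u (\<gamma> ` C)" for C
    unfolding width_image by (rule diameter_image_cong) (simp add: shift dist_real_def)
  have "\<gamma>' p \<in> slab x' u' \<mu> j \<longleftrightarrow> \<gamma> p \<in> slab x u \<mu> (j + k)" for p j
  proof -
    have "\<mu> * (of_int j + x') = \<mu> * (of_int (j + k) + x) + c"
      "\<mu> * (of_int j + 1 + x') = \<mu> * (of_int (j + k) + 1 + x) + c"
      by (simp_all add: distrib_left x')
    then show ?thesis by (simp only: slab_def mem_Collect_eq shift) simp
  qed
  then have F: "{p \<in> X. \<gamma>' p \<in> slab x' u' \<mu> j} = {p \<in> X. \<gamma> p \<in> slab x u \<mu> (j + k)}" for j
    by simp
  have ex_shift: "(\<exists>j. P (j + k)) \<longleftrightarrow> (\<exists>j. P j)" for P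
    by (metis diff_add_cancel)
  have "(\<exists>j. C \<in> components {p \<in> X. \<gamma>' p \<in> slab x' u' \<mu> j})
      \<longleftrightarrow> (\<exists>j. C \<in> components {p \<in> X. \<gamma> p \<in> slab x u \<mu> j})" for C
    unfolding F ex_shift[of "\<lambda>j. C \<in> components {p \<in> X. \<gamma> p \<in> slab x u \<mu> j}"] ..
  then have "slab_components X \<gamma>' x' u' \<mu> = slab_components X \<gamma> x u \<mu>"
    by (simp add: slab_components_def w)
  then show ?thesis unfolding slab_length_def w by (rule arg_cong)
qed

section \<open>Lower integrals under measure-preserving maps\<close>

text \<open>As \<open>f\<close> may be nonmeasurable, the transformation formula is applied to
  simple functions \<open>s\<close> below \<open>f\<close>: then \<open>s \<circ> T\<close> lies
  below \<open>f \<circ> T\<close> and has the same integral. A function below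
  \<open>f \<circ> T\<close> need not factor through \<open>T\<close>, so this argument gives only
  one inequality.\<close>

lemma nn_integral_le_measure_preserving:
  assumes T: "T \<in> measurable M M" and distr: "distr M M T = M"
  shows "(\<integral>\<^sup>+x. f x \<partial>M) \<le> (\<integral>\<^sup>+x. f (T x) \<partial>M)"
  unfolding nn_integral_def[of M f]
proof (safe intro!: SUP_least)
  fix s assume s: "simple_function M s" "s \<le> f"
  have "integral\<^sup>S M s = (\<integral>\<^sup>+x. s x \<partial>distr M M T)"
    by (simp add: distr nn_integral_eq_simple_integral[OF s(1)])
  also have "\<dots> = (\<integral>\<^sup>+x. s (T x) \<partial>M)"
    using s(1) T by (intro nn_integral_distr) (auto intro: borel_measurable_simple_function)
  also have "\<dots> \<le> (\<integral>\<^sup>+x. f (T x) \<partial>M)"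
    using s(2) by (intro nn_integral_mono) (simp add: le_fun_def)
  finally show "integral\<^sup>S M s \<le> (\<integral>\<^sup>+x. f (T x) \<partial>M)" .
qed

text \<open>The one-sided estimate is used along \<open>T\<close> for \<open>f\<close>, and along
  \<open>S\<close> for \<open>f \<circ> T\<close>, whose composite with \<open>S\<close> is
  \<open>f\<close> again.\<close>

lemma nn_integral_measure_preserving:
  assumes T: "T \<in> measurable M M" "distr M M T = M"
    and S: "S \<in> measurable M M" "distr M M S = M"
    and TS: "\<And>x. x \<in> space M \<Longrightarrow> T (S x) = x"
  shows "(\<integral>\<^sup>+x. f (T x) \<partial>M) = (\<integral>\<^sup>+x. f x \<partial>M)"
proof (rule antisym)
  have "(\<integral>\<^sup>+x. f (T x) \<partial>M) \<le> (\<integral>\<^sup>+x. f (T (S x)) \<partial>M)"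
    by (rule nn_integral_le_measure_preserving[OF S])
  also have "\<dots> = (\<integral>\<^sup>+x. f x \<partial>M)" by (intro nn_integral_cong) (simp add: TS)
  finally show "(\<integral>\<^sup>+x. f (T x) \<partial>M) \<le> (\<integral>\<^sup>+x. f x \<partial>M)" .
qed (rule nn_integral_le_measure_preserving[OF T])

text \<open>This is a rotation of the circle: with \<open>r = frac t\<close>, the interval
  \<open>{0..<1}\<close> is cut at \<open>1 - r\<close>, and the two pieces are translated by
  \<open>r\<close> and \<open>r - 1\<close>.\<close>

lemma distr_frac_add:
  fixes t :: real
  defines "M \<equiv> restrict_space lborel {0..<1::real}"
  shows "(\<lambda>x. frac (x + t)) \<in> measurable M M" "distr M M (\<lambda>x. frac (x + t)) = M"
proof -
  have fb: "(\<lambda>x. frac (x + t)) \<in> borel_measurable borel"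
    unfolding frac_def by measurable
  show m: "(\<lambda>x. frac (x + t)) \<in> measurable M M"
    unfolding M_def using fb
    by (intro measurable_restrict_space3) (auto simp: frac_lt_1)
  show "distr M M (\<lambda>x. frac (x + t)) = M"
  proof (rule measure_eqI)
    fix A assume "A \<in> sets (distr M M (\<lambda>x. frac (x + t)))"
    then have A: "A \<in> sets borel" "A \<subseteq> {0..<1}" and AM: "A \<in> sets M"
      by (auto simp: M_def sets_restrict_space)
    define r where "r = frac t"
    have r: "0 \<le> r" "r < 1" by (auto simp: r_def frac_lt_1)
    have fr: "frac (x + t) = (if x + r < 1 then x + r else x + r - 1)" if "0 \<le> x" "x < 1" for x
    proof -
      have "frac x = x" using that by simp
      then show ?thesis unfolding r_def frac_add[of x t] by simp
    qed
    let ?V = "(\<lambda>x. frac (x + t)) -` A"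
    have V: "?V \<inter> {0..<1} \<in> sets borel" using measurable_sets[OF fb A(1)] by simp
    \<comment> \<open>Points below \<open>1 - r\<close> land in \<open>{r..<1}\<close> and the
      others in \<open>{0..<r}\<close>, so the preimage splits into translates of the two parts of
      \<open>A\<close>.\<close>
    have ind: "indicator (?V \<inter> {0..<1}) x
        = (indicator (A \<inter> {r..<1}) (r + x) + indicator (A \<inter> {0..<r}) ((r - 1) + x) :: ennreal)" for x
      using A(2) r fr[of x] by (cases "0 \<le> x \<and> x < 1") (auto simp: indicator_def algebra_simps)
    have parts: "A \<inter> {r..<1} \<in> sets borel" "A \<inter> {0..<r} \<in> sets borel" using A by auto
    note [measurable] = parts
    have "emeasure (distr M M (\<lambda>x. frac (x + t))) A = emeasure M (?V \<inter> {0..<1})"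
      using emeasure_distr[OF m AM] by (simp add: M_def space_restrict_space)
    also have "\<dots> = (\<integral>\<^sup>+x. indicator (?V \<inter> {0..<1}) x \<partial>lborel)"
      using V by (simp add: M_def emeasure_restrict_space)
    also have "\<dots> = (\<integral>\<^sup>+x. indicator (A \<inter> {r..<1}) (r + x) \<partial>lborel)
        + (\<integral>\<^sup>+x. indicator (A \<inter> {0..<r}) ((r - 1) + x) \<partial>lborel)"
      unfolding ind by (intro nn_integral_add) measurable
    also have "\<dots> = (\<integral>\<^sup>+x. indicator (A \<inter> {r..<1}) x \<partial>lborel)
        + (\<integral>\<^sup>+x. indicator (A \<inter> {0..<r}) x \<partial>lborel)"
      by (intro arg_cong2[where f = "(+)"] nn_integral_lborel_translate) measurable
    also have "\<dots> = emeasure lborel ((A \<inter> {r..<1}) \<union> (A \<inter> {0..<r}))"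
      using parts by (subst plus_emeasure[symmetric]) auto
    also have "(A \<inter> {r..<1}) \<union> (A \<inter> {0..<r}) = A" using A(2) r by auto
    also have "emeasure lborel A = emeasure M A"
      using A by (simp add: M_def emeasure_restrict_space)
    finally show "emeasure (distr M M (\<lambda>x. frac (x + t))) A = emeasure M A" .
  qed simp
qed

text \<open>A function of period 1 lives on the circle, where the shift by \<open>t\<close> becomes
  the measure-preserving rotation \<open>frac (x + t)\<close>, inverted by the rotation by
  \<open>-t\<close>.\<close>

lemma nn_integral_unit_interval_periodic:
  fixes f :: "real \<Rightarrow> ennreal"
  assumes per: "\<And>x k. f (x + of_int k) = f x"
  shows "(\<integral>\<^sup>+x\<in>{0..1}. f (x + t) \<partial>lborel) = (\<integral>\<^sup>+x\<in>{0..1}. f x \<partial>lborel)"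
proof -
  define M where "M = restrict_space lborel {0..<1::real}"
  have frac: "f (frac x) = f x" for x
    using per[of x "- \<lfloor>x\<rfloor>"] by (simp add: frac_def)
  \<comment> \<open>The endpoint 1 is a null set; without it the rotation is a bijection of the
    interval.\<close>
  have eq: "(\<integral>\<^sup>+x\<in>{0..1}. g x \<partial>lborel) = (\<integral>\<^sup>+x. g x \<partial>M)" for g :: "real \<Rightarrow> ennreal"
    unfolding M_def
    by (subst nn_integral_restrict_space, simp)
       (intro nn_integral_cong_AE eventually_mono[OF AE_lborel_singleton[of 1]], auto simp: indicator_def)
  have "(\<integral>\<^sup>+x. f (frac (x + t)) \<partial>M) = (\<integral>\<^sup>+x. f x \<partial>M)"
  proof (rule nn_integral_measure_preserving)
    show "frac (frac (x + - t) + t) = x" if "x \<in> space M" for x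
    proof -
      have "frac (frac (x + - t) + t) = frac (x - of_int \<lfloor>x - t\<rfloor>)" by (simp add: frac_def)
      also have "\<dots> = x"
        using that frac_add_of_int_right[of x "- \<lfloor>x - t\<rfloor>"] by (simp add: M_def space_restrict_space)
      finally show ?thesis .
    qed
  qed (use distr_frac_add[of t] distr_frac_add[of "-t"] in \<open>simp_all add: M_def\<close>)
  then show ?thesis by (simp add: eq frac)
qed

lemma nn_integral_sphere_orthogonal:
  fixes f :: "real^'n \<Rightarrow> real^'n"
  assumes f: "orthogonal_transformation f"
  shows "(\<integral>\<^sup>+u. G (f u) \<partial>sphere_measure) = (\<integral>\<^sup>+u. G u \<partial>sphere_measure)"
proof -
  have meas: "g \<in> measurable sphere_measure sphere_measure" if "orthogonal_transformation g" for g :: "real^'n \<Rightarrow> real^'n"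
  proof -
    have "g \<in> borel_measurable borel"
      using that by (intro borel_measurable_continuous_onI linear_continuous_on)
        (simp add: orthogonal_transformation_linear linear_linear)
    then show ?thesis
      unfolding measurable_cong_sets[OF sets_sphere_measure sets_sphere_measure]
      using that by (intro measurable_restrict_space3) (auto simp: orthogonal_transformation_norm)
  qed
  have inv: "orthogonal_transformation (inv f)" using f by (rule orthogonal_transformation_inv)
  show ?thesis
    using f inv
    by (intro nn_integral_measure_preserving[where S = "inv f"] meas distr_sphere_measure_orthogonal)
       (auto simp: surj_f_inv_f orthogonal_transformation_surj)
qed

section \<open>Positivity\<close>

text \<open>The measure of the cap is the proportion of the unit ball lying in the cone over it.
  This part of the cone is open and nonempty, so it contains a small ball.\<close>

lemma emeasure_sphere_cap_pos:
  fixes v :: "real^'n"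
  assumes "v \<noteq> 0"
  shows "emeasure sphere_measure {u. norm u = 1 \<and> norm v / 2 < v \<bullet> u} > 0"
    (is "emeasure _ ?U > 0")
proof -
  have Us: "?U = sphere 0 1 \<inter> {u. norm v / 2 < v \<bullet> u}" by auto
  have U: "?U \<in> sets borel"
    unfolding Us by (intro sets.Int borel_closed borel_open open_Collect_less continuous_intros) auto
  let ?W = "{z. norm z < 1 \<and> z \<noteq> 0 \<and> norm v / 2 * norm z < v \<bullet> z}"
  \<comment> \<open>The condition on \<open>sgn z\<close> is multiplied by \<open>norm z\<close>;
    the origin drops out because \<open>sgn 0 = 0\<close> is not on the sphere.\<close>
  have W: "ball 0 1 \<inter> sgn -` ?U = ?W"
    by (auto simp: norm_sgn) (auto simp: sgn_div_norm field_simps)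
  have "open ?W"
    by (intro open_Collect_conj open_Collect_less open_Collect_neq continuous_intros)
  \<comment> \<open>This vector has norm \<open>1 / 2\<close> and inner product
    \<open>norm v / 2\<close> with \<open>v\<close>, twice the required bound
    \<open>norm v / 4\<close>.\<close>
  moreover have "(1 / (2 * norm v)) *\<^sub>R v \<in> ?W"
    using assms by (simp add: power2_norm_eq_inner[symmetric] power2_eq_square field_simps)
  ultimately obtain e where e: "e > 0" "ball ((1 / (2 * norm v)) *\<^sub>R v) e \<subseteq> ?W"
    by (meson openE)
  have "0 < emeasure lborel (ball ((1 / (2 * norm v)) *\<^sub>R v) e)"
    using e(1) by (simp add: emeasure_ball unit_ball_vol_pos)
  also have "\<dots> \<le> emeasure lborel ?W"
    using e(2) \<open>open ?W\<close> by (intro emeasure_mono) auto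
  finally have "0 < emeasure lborel ?W" .
  moreover have "?U \<subseteq> sphere 0 1" by auto
  ultimately show ?thesis
    using emeasure_lborel_unit_ball(2)[where 'a = "real^'n"]
    by (simp only: emeasure_sphere_measure[OF U] W ennreal_zero_less_divide)
       (simp add: less_top[symmetric])
qed

text \<open>The integrand is at least \<open>c / 4\<close> when \<open>\<mu>\<close> lies in
  \<open>{c/2..c}\<close>, \<open>u\<close> in a cap around the direction of \<open>v\<close>, and
  \<open>x\<close> in \<open>{0..1}\<close>; all three sets have positive measure.\<close>

lemma len_pos:
  fixes X :: "'a::metric_space set" and \<gamma> :: "'a \<Rightarrow> real^'n"
  assumes path: "generalized_path X \<gamma>" and nc: "\<not> \<gamma> constant_on X"
  shows "len X \<gamma> > 0"
proof -
  obtain p q where pq: "p \<in> X" "q \<in> X" "\<gamma> p \<noteq> \<gamma> q"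
    using nc by (auto simp: constant_on_def) metis
  define v where "v = \<gamma> p - \<gamma> q"
  define U where "U = {u. norm u = 1 \<and> norm v / 2 < v \<bullet> u}"
  \<comment> \<open>For \<open>\<mu> \<le> c\<close> and \<open>u\<close> in the cap,
    \<open>2 * \<mu> \<le> norm v / 2 < v \<bullet> u\<close>, as the lower bound demands; the
    minimum with 1 keeps \<open>{c/2..c}\<close> inside \<open>{0<..1}\<close>.\<close>
  define c where "c = min 1 (norm v / 4)"
  have c: "0 < c" "c \<le> 1" "c \<le> norm v / 4" using pq by (auto simp: c_def v_def)
  have U: "U \<in> sets sphere_measure"
  proof -
    have "U = sphere 0 1 \<inter> {u. norm v / 2 < v \<bullet> u}" by (auto simp: U_def)
    moreover have "{u. norm v / 2 < v \<bullet> u} \<in> sets borel"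
      by (intro borel_open open_Collect_less continuous_intros)
    ultimately show ?thesis
      unfolding sets_sphere_measure sets_restrict_space by (rule image_eqI)
  qed
  have bound: "ennreal (c / 4) \<le> ennreal (slab_length X \<gamma> x u \<mu>)" if "u \<in> U" "\<mu> \<in> {c/2..c}" for x u \<mu>
  proof -
    have "\<mu> / 2 \<le> slab_length X \<gamma> x u \<mu>"
      using that c by (intro slab_length_lower_bound[OF path pq(1,2)])
        (auto simp: U_def v_def inner_diff_left inner_diff_right)
    then show ?thesis using that by (intro ennreal_leI) auto
  qed
  \<comment> \<open>Working from the inside out, each integral is minorised by a multiple of an
    indicator, so monotonicity suffices.\<close>
  have x_bound: "ennreal (c / 4) * indicator U u
      \<le> (\<integral>\<^sup>+x\<in>{0..1}. ennreal (slab_length X \<gamma> x u \<mu>) \<partial>lborel)" if "\<mu> \<in> {c/2..c}" for u \<mu>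
  proof (cases "u \<in> U")
    case True
    have "ennreal (c / 4) = (\<integral>\<^sup>+x\<in>{0..1::real}. ennreal (c / 4) \<partial>lborel)"
      by (simp add: nn_integral_cmult_indicator)
    also have "\<dots> \<le> (\<integral>\<^sup>+x\<in>{0..1}. ennreal (slab_length X \<gamma> x u \<mu>) \<partial>lborel)"
      using bound[OF True that] by (intro nn_integral_mono mult_right_mono) auto
    finally show ?thesis using True by simp
  qed simp
  have u_bound: "ennreal (c / 4) * emeasure sphere_measure U
      \<le> (\<integral>\<^sup>+u. (\<integral>\<^sup>+x\<in>{0..1}. ennreal (slab_length X \<gamma> x u \<mu>) \<partial>lborel) \<partial>sphere_measure)"
    if "\<mu> \<in> {c/2..c}" for \<mu>
    using x_bound[OF that] U
    by (subst nn_integral_cmult_indicator[symmetric]) (auto intro!: nn_integral_mono)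
  let ?m = "ennreal (c / 4) * emeasure sphere_measure U"
  have "emeasure sphere_measure U > 0"
    unfolding U_def using pq by (intro emeasure_sphere_cap_pos) (simp add: v_def)
  then have "0 < ?m * ennreal (c / 2)"
    using c by (simp add: ennreal_zero_less_mult_iff)
  also have "\<dots> = (\<integral>\<^sup>+\<mu>. ?m * indicator {c/2..c} \<mu> \<partial>lborel)"
    using c by (subst nn_integral_cmult_indicator) auto
  also have "\<dots> \<le> len X \<gamma>"
    unfolding len_def
    using u_bound c by (intro nn_integral_mono) (auto simp: indicator_def)
  finally show ?thesis .
qed

section \<open>Invariance under isometries\<close>

lemma len_isometry:
  fixes \<gamma> :: "'a::metric_space \<Rightarrow> real^'n" and \<Phi> :: "real^'n \<Rightarrow> real^'n"
  assumes iso: "\<And>z w. dist (\<Phi> z) (\<Phi> w) = dist z w"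
  shows "len X (\<Phi> \<circ> \<gamma>) = len X \<gamma>"
proof -
  \<comment> \<open>Removing the translation leaves a distance-preserving map that fixes the origin,
    hence a linear orthogonal one.\<close>
  define Q where "Q z = \<Phi> z - \<Phi> 0" for z
  have Q: "orthogonal_transformation Q"
    unfolding orthogonal_transformation_isometry using iso by (simp add: Q_def dist_norm)
  define R where "R = inv Q"
  have R: "orthogonal_transformation R"
    unfolding R_def using Q by (rule orthogonal_transformation_inv)
  have QR: "Q (R u) = u" for u
    using Q by (simp add: R_def surj_f_inv_f orthogonal_transformation_surj)
  have inner: "\<Phi> z \<bullet> u = z \<bullet> R u + \<Phi> 0 \<bullet> u" for z u
  proof -
    have "Q z \<bullet> Q (R u) = z \<bullet> R u" using Q by (simp add: orthogonal_transformation_def)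
    then show ?thesis unfolding QR by (simp add: Q_def inner_diff_left)
  qed
  have "(\<integral>\<^sup>+u. (\<integral>\<^sup>+x\<in>{0..1}. ennreal (slab_length X (\<Phi> \<circ> \<gamma>) x u \<mu>) \<partial>lborel) \<partial>sphere_measure)
      = (\<integral>\<^sup>+u. (\<integral>\<^sup>+x\<in>{0..1}. ennreal (slab_length X \<gamma> x u \<mu>) \<partial>lborel) \<partial>sphere_measure)"
    if \<mu>: "\<mu> > 0" for \<mu>
  proof -
    have per: "slab_length X \<gamma> (x + of_int k) u \<mu> = slab_length X \<gamma> x u \<mu>" for x k u
      by (rule slab_length_affine[where c = 0 and k = k]) (simp_all add: algebra_simps)
    \<comment> \<open>By \<open>inner\<close>, the projection to \<open>u\<close> after
      \<open>\<Phi>\<close> is the projection to \<open>R u\<close> plus a constant, which the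
      offset absorbs after division by \<open>\<mu>\<close>.\<close>
    have shift: "slab_length X (\<Phi> \<circ> \<gamma>) x u \<mu> = slab_length X \<gamma> (x + - (\<Phi> 0 \<bullet> u / \<mu>)) (R u) \<mu>" for x u
    proof (rule slab_length_affine[where c = "\<Phi> 0 \<bullet> u" and k = 0])
      show "(\<Phi> \<circ> \<gamma>) p \<bullet> u = \<gamma> p \<bullet> R u + \<Phi> 0 \<bullet> u" for p
        unfolding o_apply by (rule inner)
    qed (use \<mu> in \<open>simp add: algebra_simps\<close>)
    \<comment> \<open>The shift of \<open>x\<close> depends on \<open>u\<close> and
      \<open>\<mu>\<close>, so it is removed in the innermost integral first; what remains depends
      on \<open>u\<close> only through \<open>R u\<close>.\<close>
    have "(\<integral>\<^sup>+x\<in>{0..1}. ennreal (slab_length X (\<Phi> \<circ> \<gamma>) x u \<mu>) \<partial>lborel)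
        = (\<integral>\<^sup>+x\<in>{0..1}. ennreal (slab_length X \<gamma> x (R u) \<mu>) \<partial>lborel)" for u
      unfolding shift
      by (rule nn_integral_unit_interval_periodic[of "\<lambda>x. ennreal (slab_length X \<gamma> x (R u) \<mu>)"])
         (simp add: per)
    then show ?thesis
      using nn_integral_sphere_orthogonal[OF R,
          of "\<lambda>u. \<integral>\<^sup>+x\<in>{0..1}. ennreal (slab_length X \<gamma> x u \<mu>) \<partial>lborel"]
      by simp
  qed
  then show ?thesis
    unfolding len_def by (intro nn_integral_cong) (auto simp: indicator_def)
qed

theorem proposition4:
  fixes X :: "'a::metric_space set" and \<gamma> :: "'a \<Rightarrow> real^'n"
  assumes "CARD('n) \<ge> 2" and "generalized_path X \<gamma>"
  shows "(len X \<gamma> = 0 \<longleftrightarrow> \<gamma> constant_on X) \<and>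
    (\<forall>(Y :: 'b::metric_space set) h.
        (\<exists>g. homeomorphism Y X h g) \<longrightarrow> len Y (\<gamma> \<circ> h) = len X \<gamma>) \<and>
    (\<forall>\<Phi> :: real^'n \<Rightarrow> real^'n.
        (\<forall>z w. dist (\<Phi> z) (\<Phi> w) = dist z w) \<longrightarrow> len X (\<Phi> \<circ> \<gamma>) = len X \<gamma>)"
proof (intro conjI allI impI)
  have "len X \<gamma> = 0" if "\<gamma> constant_on X"
    by (simp add: len_def slab_length_constant[OF that])
  then show "len X \<gamma> = 0 \<longleftrightarrow> \<gamma> constant_on X"
    using len_pos[OF assms(2)] by (metis less_irrefl)
next
  fix Y :: "'b set" and h
  assume "\<exists>g. homeomorphism Y X h g"
  then obtain g where g: "homeomorphism Y X h g" by blast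
  show "len Y (\<gamma> \<circ> h) = len X \<gamma>"
    unfolding len_def slab_length_homeomorphism[OF assms(2) g] ..
next
  fix \<Phi> :: "real^'n \<Rightarrow> real^'n"
  assume "\<forall>z w. dist (\<Phi> z) (\<Phi> w) = dist z w"
  then show "len X (\<Phi> \<circ> \<gamma>) = len X \<gamma>" by (intro len_isometry) simp
qed

end
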